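(* For every integer $m \geq 2$, let $G_{m,\mathbb{F}_4} := \mathrm{SL}(2,\mathbb{F}_4) \ltimes \mathrm{M}(2 \times m, \mathbb{F}_4)$, where $\mathrm{SL}(2,\mathbb{F}_4)$ acts on the additive group of $\mathrm{M}(2 \times m,\mathbb{F}_4)$ by matrix multiplication from the left. Then $\omega(G_{m,\mathbb{F}_4}) = 7$ for all $m \geq 2$. In particular there are infinitely many (pairwise non-isomorphic) finite non-solvable groups $G$ with $\omega(G) = 7$.
   Context: For a group $G$, $\omega(G)$ denotes the number of orbits of the natural action of the automorphism group $\mathrm{Aut}(G)$ on $G$. $\mathbb{F}_4$ is the field with $4$ elements, and $\mathrm{M}(2 \times m,\mathbb{F}_4)$ is the $\mathbb{F}_4$-vector space of $2 \times m$ matrices with entries in $\mathbb{F}_4$. *)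

theory Defs
  imports
    "HOL-Algebra.Group_Action"
    "HOL-Algebra.Solvable_Groups"
    "HOL-Library.Z2"
    "Jordan_Normal_Form.Determinant"
begin

text \<open>The field with four elements, as \<open>\<bbbF>\<^sub>2[w]/(w\<^sup>2 + w + 1)\<close>: the element \<open>GF4 a b\<close> is \<open>a + b w\<close>.
  Every nonzero \<open>x\<close> satisfies \<open>x\<^sup>3 = 1\<close>, so its inverse is \<open>x\<^sup>2 = (a + b) + b w\<close>.\<close>

datatype gf4 = GF4 bit bit

lemma gf4_exhaust:
  obtains "x = GF4 0 0" | "x = GF4 1 0" | "x = GF4 0 1" | "x = GF4 1 1"
proof (cases x)
  case (GF4 a b)
  then show ?thesis using that by (cases a; cases b) simp_all
qed

instantiation gf4 :: field
begin

definition zero_gf4 :: gf4 where "0 = GF4 0 0"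

definition one_gf4 :: gf4 where "1 = GF4 1 0"

fun plus_gf4 :: "gf4 \<Rightarrow> gf4 \<Rightarrow> gf4" where
  "GF4 a b + GF4 c d = GF4 (a + c) (b + d)"

fun uminus_gf4 :: "gf4 \<Rightarrow> gf4" where
  "- GF4 a b = GF4 (- a) (- b)"

fun minus_gf4 :: "gf4 \<Rightarrow> gf4 \<Rightarrow> gf4" where
  "GF4 a b - GF4 c d = GF4 (a - c) (b - d)"

fun times_gf4 :: "gf4 \<Rightarrow> gf4 \<Rightarrow> gf4" where
  "GF4 a b * GF4 c d = GF4 (a * c + b * d) (a * d + b * c + b * d)"

fun inverse_gf4 :: "gf4 \<Rightarrow> gf4" where
  "inverse (GF4 a b) = GF4 (a + b) b"

definition divide_gf4 :: "gf4 \<Rightarrow> gf4 \<Rightarrow> gf4" where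
  "x div y = x * inverse y" for x y :: gf4

instance
proof
  fix x y z :: gf4
  show "x * y * z = x * (y * z)"
    by (cases x rule: gf4_exhaust; cases y rule: gf4_exhaust; cases z rule: gf4_exhaust) simp_all
  show "x * y = y * x"
    by (cases x rule: gf4_exhaust; cases y rule: gf4_exhaust) simp_all
  show "1 * x = x"
    by (cases x rule: gf4_exhaust) (simp_all add: one_gf4_def)
  show "x + y + z = x + (y + z)"
    by (cases x rule: gf4_exhaust; cases y rule: gf4_exhaust; cases z rule: gf4_exhaust) simp_all
  show "x + y = y + x"
    by (cases x rule: gf4_exhaust; cases y rule: gf4_exhaust) simp_all
  show "0 + x = x"
    by (cases x rule: gf4_exhaust) (simp_all add: zero_gf4_def)
  show "- x + x = 0"
    by (cases x rule: gf4_exhaust) (simp_all add: zero_gf4_def)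
  show "x - y = x + - y"
    by (cases x rule: gf4_exhaust; cases y rule: gf4_exhaust) simp_all
  show "(x + y) * z = x * z + y * z"
    by (cases x rule: gf4_exhaust; cases y rule: gf4_exhaust; cases z rule: gf4_exhaust) simp_all
  show "(0 :: gf4) \<noteq> 1"
    by (simp add: zero_gf4_def one_gf4_def)
  show "inverse x * x = 1" if "x \<noteq> 0"
    using that by (cases x rule: gf4_exhaust) (simp_all add: zero_gf4_def one_gf4_def)
  show "x div y = x * inverse y"
    by (rule divide_gf4_def)
  show "inverse (0 :: gf4) = 0"
    by (simp add: zero_gf4_def)
qed

end

lemma UNIV_gf4: "(UNIV :: gf4 set) = {GF4 0 0, GF4 1 0, GF4 0 1, GF4 1 1}"
  by (auto intro: gf4_exhaust)

lemma card_UNIV_gf4: "card (UNIV :: gf4 set) = 4"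
  by (simp add: UNIV_gf4)


text \<open>The pair \<open>(h, n)\<close> stands for the product \<open>n h\<close>, with \<open>h n h\<inverse> = \<phi> h n\<close>.\<close>

definition semidirect_product ::
  "('h, 'x) monoid_scheme \<Rightarrow> ('n, 'y) monoid_scheme \<Rightarrow> ('h \<Rightarrow> 'n \<Rightarrow> 'n) \<Rightarrow> ('h \<times> 'n) monoid" where
  "semidirect_product H N \<phi> =
     \<lparr>carrier = carrier H \<times> carrier N,
      monoid.mult = (\<lambda>(h, n) (h', n'). (h \<otimes>\<^bsub>H\<^esub> h', n \<otimes>\<^bsub>N\<^esub> \<phi> h n')),
      one = (\<one>\<^bsub>H\<^esub>, \<one>\<^bsub>N\<^esub>)\<rparr>"

lemma group_semidirect_product:
  assumes H: "group H" and N: "group N"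
    and hom: "\<And>h. h \<in> carrier H \<Longrightarrow> \<phi> h \<in> hom N N"
    and one: "\<And>n. n \<in> carrier N \<Longrightarrow> \<phi> \<one>\<^bsub>H\<^esub> n = n"
    and mult: "\<And>h h' n. \<lbrakk>h \<in> carrier H; h' \<in> carrier H; n \<in> carrier N\<rbrakk>
                 \<Longrightarrow> \<phi> (h \<otimes>\<^bsub>H\<^esub> h') n = \<phi> h (\<phi> h' n)"
  shows "group (semidirect_product H N \<phi>)"
proof -
  interpret H: group H by (rule H)
  interpret N: group N by (rule N)
  have closed: "\<phi> h n \<in> carrier N" if "h \<in> carrier H" "n \<in> carrier N" for h n
    using hom[OF that(1)] that(2) by (rule hom_in_carrier)
  have distr: "\<phi> h (n \<otimes>\<^bsub>N\<^esub> n') = \<phi> h n \<otimes>\<^bsub>N\<^esub> \<phi> h n'"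
    if "h \<in> carrier H" "n \<in> carrier N" "n' \<in> carrier N" for h n n'
    using hom_mult[OF hom[OF that(1)] that(2,3)] .
  show ?thesis
  proof (rule groupI)
    fix x assume "x \<in> carrier (semidirect_product H N \<phi>)"
    then obtain h n where x: "x = (h, n)" "h \<in> carrier H" "n \<in> carrier N"
      by (auto simp: semidirect_product_def)
    let ?h = "inv\<^bsub>H\<^esub> h"
    let ?y = "(?h, inv\<^bsub>N\<^esub> (\<phi> ?h n))"
    have "?y \<in> carrier (semidirect_product H N \<phi>)"
      using x closed by (simp add: semidirect_product_def)
    moreover have "?y \<otimes>\<^bsub>semidirect_product H N \<phi>\<^esub> x = \<one>\<^bsub>semidirect_product H N \<phi>\<^esub>"
      using x closed by (simp add: semidirect_product_def N.l_inv)
    ultimately show "\<exists>y \<in> carrier (semidirect_product H N \<phi>).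
        y \<otimes>\<^bsub>semidirect_product H N \<phi>\<^esub> x = \<one>\<^bsub>semidirect_product H N \<phi>\<^esub>" by blast
  qed (auto simp: semidirect_product_def closed distr one mult H.m_assoc N.m_assoc)
qed


definition special_linear_group :: "nat \<Rightarrow> 'a :: field mat monoid" where
  "special_linear_group n =
     \<lparr>carrier = {A \<in> carrier_mat n n. det A = 1}, monoid.mult = (*), one = 1\<^sub>m n\<rparr>"

text \<open>\<open>G\<^bsub>m,K\<^esub> = SL(2,K) \<ltimes> M(2 \<times> m, K)\<close>\<close>

definition SL2_ltimes_mat :: "nat \<Rightarrow> ('a :: field mat \<times> 'a mat) monoid" where
  "SL2_ltimes_mat m =
     semidirect_product (special_linear_group 2) (add_monoid (module_mat TYPE('a) 2 m)) (\<lambda>A X. A * X)"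

text \<open>\<open>\<omega>(G)\<close>; for infinitely many orbits, this definition gives \<open>0\<close>.\<close>

definition num_aut_orbits :: "('a, 'b) monoid_scheme \<Rightarrow> nat" where
  "num_aut_orbits G = card (orbits (AutoGroup G) (carrier G) (\<lambda>f. f))"


lemma group_special_linear_group: "group (special_linear_group n :: 'a :: field mat monoid)"
proof (rule groupI)
  fix A :: "'a mat" assume "A \<in> carrier (special_linear_group n)"
  then have A: "A \<in> carrier_mat n n" "det A = 1" by (auto simp: special_linear_group_def)
  let ?B = "adj_mat A"
  have B: "?B \<in> carrier_mat n n" "?B * A = 1\<^sub>m n"
    using adj_mat[OF A(1)] A(2) by auto
  then have "det ?B = 1"
    using det_mult[OF B(1) A(1)] A(2) by simp
  then show "\<exists>B \<in> carrier (special_linear_group n).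
      B \<otimes>\<^bsub>special_linear_group n\<^esub> A = \<one>\<^bsub>special_linear_group n\<^esub>"
    using B by (auto simp: special_linear_group_def)
qed (auto simp: special_linear_group_def det_mult assoc_mult_mat[of _ n n _ n _ n])

lemma group_SL2_ltimes_mat: "group (SL2_ltimes_mat m :: ('a :: field mat \<times> 'a mat) monoid)"
  unfolding SL2_ltimes_mat_def
proof (rule group_semidirect_product)
  show "group (add_monoid (module_mat TYPE('a) 2 m))"
    by (rule comm_group.axioms(2), rule abelian_group.a_comm_group) (rule abelian_group_mat)
qed (rule group_special_linear_group,
     auto simp: special_linear_group_def module_mat_def hom_def
       assoc_mult_mat[of _ 2 2 _ 2 _ m] mult_add_distrib_mat[of _ 2 2 _ m])

end

theory Submission
  imports Defs "Jordan_Normal_Form.Gauss_Jordan_Elimination"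
begin

text \<open>Every element is brought into one of seven normal forms by the automorphisms
  \<open>(A, X) \<mapsto> (P A P\<inverse>, P X Q)\<close> with \<open>P\<close> in \<open>GL\<^sub>2\<close> and \<open>Q\<close> in \<open>GL\<^sub>m\<close>, conjugation by \<open>(1, Y)\<close>, and
  the Frobenius. If \<open>A = 1\<close>, only the rank of \<open>X\<close> matters. If \<open>A \<noteq> 1\<close>, then \<open>A\<close> is conjugate in
  \<open>GL\<^sub>2\<close> to the companion matrix of its characteristic polynomial, that is, to a matrix given by its
  trace \<open>t\<close>, and \<open>X\<close> matters only modulo the image of \<open>1 - A\<close>. This image is everything for
  \<open>t \<noteq> 0\<close>, as \<open>det (1 - A) = t\<close> in characteristic two; for \<open>t = 0\<close> what remains of \<open>X\<close> is a row,
  zero or not. The Frobenius swaps the two traces outside the prime field.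

  The orders of elements, being a square, and commuting with all of one's conjugates tell the seven
  normal forms apart.

  The transvections together with one diagonal matrix form a set contained in the derived subgroup
  that it generates, hence in every term of the derived series.\<close>

section \<open>Orbits of the automorphism group\<close>

text \<open>Elements of \<open>AutoGroup G\<close> are extensional on the carrier while those of
  \<open>iso G G\<close> are arbitrary outside it; restriction passes from the latter to the former
  without changing the value at \<open>x\<close>.\<close>

lemma (in group) orbit_AutoGroup:
  assumes "x \<in> carrier G"
  shows "orbit (AutoGroup G) (\<lambda>f. f) x = (\<lambda>f. f x) ` iso G G"
proof (intro equalityI subsetI)
  fix y assume "y \<in> orbit (AutoGroup G) (\<lambda>f. f) x"
  then obtain f where "f \<in> auto G" "y = f x"
    by (auto simp: orbit_def AutoGroup_def)
  moreover from this have "f \<in> iso G G"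
    by (auto simp: auto_def iso_def Bij_def)
  ultimately show "y \<in> (\<lambda>f. f x) ` iso G G" by blast
next
  fix y assume "y \<in> (\<lambda>f. f x) ` iso G G"
  then obtain f where f: "f \<in> hom G G" "bij_betw f (carrier G) (carrier G)" "y = f x"
    by (auto simp: iso_def)
  let ?g = "restrict f (carrier G)"
  have "?g \<in> hom G G" using f(1) by (auto simp: hom_def)
  moreover have "bij_betw ?g (carrier G) (carrier G)"
    using f(2) by (simp cong: bij_betw_cong)
  ultimately have "?g \<in> auto G" by (auto simp: auto_def Bij_def)
  with f(3) assms show "y \<in> orbit (AutoGroup G) (\<lambda>f. f) x"
    by (auto simp: orbit_def AutoGroup_def intro!: exI[of _ ?g])
qed

text \<open>Membership of \<open>x\<close> in the carrier is part of the relation because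
  \<open>f\<close> is unconstrained elsewhere; membership of \<open>y\<close> follows from
  it.\<close>

definition aut_equiv :: "('a, 'b) monoid_scheme \<Rightarrow> 'a \<Rightarrow> 'a \<Rightarrow> bool" where
  "aut_equiv G x y \<longleftrightarrow> x \<in> carrier G \<and> (\<exists>f \<in> iso G G. f x = y)"

lemma aut_equivI: "f \<in> iso G G \<Longrightarrow> x \<in> carrier G \<Longrightarrow> f x = y \<Longrightarrow> aut_equiv G x y"
  by (auto simp: aut_equiv_def)

lemma aut_equiv_in_carrier: "aut_equiv G x y \<Longrightarrow> y \<in> carrier G"
  by (auto simp: aut_equiv_def iso_def hom_def)

lemma aut_equiv_trans [trans]:
  assumes "aut_equiv G x y" "aut_equiv G y z"
  shows "aut_equiv G x z"
proof -
  obtain f g where "f \<in> iso G G" "f x = y" "g \<in> iso G G" "g y = z"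
    using assms by (auto simp: aut_equiv_def)
  then show ?thesis
    using assms(1) iso_set_trans[of f G G g G] by (auto simp: aut_equiv_def intro!: bexI[of _ "g \<circ> f"])
qed

lemma (in group) aut_equiv_sym:
  assumes "aut_equiv G x y"
  shows "aut_equiv G y x"
proof -
  obtain f where f: "f \<in> iso G G" "f x = y" "x \<in> carrier G"
    using assms by (auto simp: aut_equiv_def)
  have "inv_into (carrier G) f y = x"
    using f by (auto simp: iso_def bij_betw_def inv_into_f_f)
  with iso_set_sym[OF f(1)] aut_equiv_in_carrier[OF assms] show ?thesis
    by (auto simp: aut_equiv_def)
qed

text \<open>Sending \<open>r\<close> to its orbit is a bijection from \<open>R\<close> to the
  orbits: every orbit meets \<open>R\<close>, and two representatives in one orbit share the value
  of the invariant \<open>c\<close>, which is injective on \<open>R\<close>.\<close>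

lemma (in group) num_aut_orbits_eq_card_representatives:
  assumes R: "\<And>x. x \<in> carrier G \<Longrightarrow> \<exists>r \<in> R. aut_equiv G x r"
    and sub: "R \<subseteq> carrier G"
    and inv: "\<And>x y. aut_equiv G x y \<Longrightarrow> c x = c y"
    and inj: "inj_on c R"
  shows "num_aut_orbits G = card R"
proof -
  let ?orb = "\<lambda>x. {y. aut_equiv G x y}"
  have orb: "orbit (AutoGroup G) (\<lambda>f. f) x = ?orb x" if "x \<in> carrier G" for x
    using that by (auto simp: orbit_AutoGroup aut_equiv_def)
  have orb_R: "?orb x \<in> ?orb ` R" if x: "x \<in> carrier G" for x
  proof -
    from R[OF x] obtain r where r: "r \<in> R" "aut_equiv G x r" by blast
    then have "aut_equiv G x y \<longleftrightarrow> aut_equiv G r y" for y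
      using aut_equiv_trans[of G x r y] aut_equiv_trans[of G r x y] aut_equiv_sym[of x r] by blast
    with r(1) have "?orb x = ?orb r" "r \<in> R" by simp_all
    then show ?thesis by blast
  qed
  have "orbits (AutoGroup G) (carrier G) (\<lambda>f. f) = ?orb ` carrier G"
    unfolding orbits_def Setcompr_eq_image by (rule image_cong) (simp_all add: orb)
  also have "\<dots> = ?orb ` R"
    by (intro equalityI image_mono sub image_subsetI orb_R)
  finally have "orbits (AutoGroup G) (carrier G) (\<lambda>f. f) = ?orb ` R" .
  moreover have "inj_on ?orb R"
  proof (rule inj_onI)
    fix r s assume rs: "r \<in> R" "s \<in> R" and eq: "?orb r = ?orb s"
    have "s \<in> ?orb s"
      using rs sub by (auto intro: aut_equivI[OF iso_set_refl])
    with eq have "aut_equiv G r s" by auto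
    from inv[OF this] show "r = s" using inj rs by (auto dest: inj_onD)
  qed
  ultimately show ?thesis by (simp add: num_aut_orbits_def card_image)
qed

section \<open>Invariants under automorphisms\<close>

text \<open>The equation \<open>h g = k h\<close> says that \<open>k\<close> is the conjugate of
  \<open>g\<close> by \<open>h\<close>, without mentioning an inverse.\<close>

definition commutes_with_conjugates :: "('a, 'b) monoid_scheme \<Rightarrow> 'a \<Rightarrow> bool" where
  "commutes_with_conjugates G g \<longleftrightarrow>
     (\<forall>h \<in> carrier G. \<forall>k \<in> carrier G. h \<otimes>\<^bsub>G\<^esub> g = k \<otimes>\<^bsub>G\<^esub> h \<longrightarrow> g \<otimes>\<^bsub>G\<^esub> k = k \<otimes>\<^bsub>G\<^esub> g)"

definition is_group_square :: "('a, 'b) monoid_scheme \<Rightarrow> 'a \<Rightarrow> bool" where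
  "is_group_square G g \<longleftrightarrow> (\<exists>h \<in> carrier G. h \<otimes>\<^bsub>G\<^esub> h = g)"

text \<open>The numbers are the positions in the list \<open>representatives\<close>. The value 4 is
  the default, left for all orders other than 1, 2, 3 and 5; among the normal forms it marks the one
  of order 4.\<close>

definition aut_label :: "('a, 'b) monoid_scheme \<Rightarrow> 'a \<Rightarrow> nat" where
  "aut_label G g =
     (if g = \<one>\<^bsub>G\<^esub> then 0
      else if g \<otimes>\<^bsub>G\<^esub> g = \<one>\<^bsub>G\<^esub> then
        (if commutes_with_conjugates G g then (if is_group_square G g then 1 else 2) else 3)
      else if g \<otimes>\<^bsub>G\<^esub> (g \<otimes>\<^bsub>G\<^esub> g) = \<one>\<^bsub>G\<^esub> then 5
      else if g \<otimes>\<^bsub>G\<^esub> (g \<otimes>\<^bsub>G\<^esub> (g \<otimes>\<^bsub>G\<^esub> (g \<otimes>\<^bsub>G\<^esub> g))) = \<one>\<^bsub>G\<^esub> then 6 else 4)"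

text \<open>All tests are phrased by the group operation alone, so an isomorphism transports them.
  For commuting with conjugates and for being a square one implication is proved, and
  \<open>aut_equiv_sym\<close> gives the other.\<close>

lemma (in group) aut_label_cong:
  assumes "aut_equiv G x y"
  shows "aut_label G x = aut_label G y"
proof -
  have comm: "commutes_with_conjugates G v" 
    if uv: "aut_equiv G u v" and u: "commutes_with_conjugates G u" for u v
  proof -
    obtain f where f: "f \<in> hom G G" "bij_betw f (carrier G) (carrier G)" "f u = v" "u \<in> carrier G"
      using uv by (auto simp: aut_equiv_def iso_def)
    note hom = hom_mult[OF f(1)]
    show ?thesis unfolding commutes_with_conjugates_def
    proof (intro ballI impI)
      fix h k assume "h \<in> carrier G" "k \<in> carrier G" and hk: "h \<otimes> v = k \<otimes> h"
      moreover have "h \<in> f ` carrier G" "k \<in> f ` carrier G"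
        using calculation f(2) by (simp_all add: bij_betw_def)
      then obtain h' k' where h'k': "h' \<in> carrier G" "k' \<in> carrier G" "h = f h'" "k = f k'"
        by blast
      from hk h'k' f(3,4) have "f (h' \<otimes> u) = f (k' \<otimes> h')" by (simp add: hom)
      then have "h' \<otimes> u = k' \<otimes> h'"
        using f(2,4) h'k' by (auto simp: bij_betw_def dest: inj_onD)
      with u h'k' have "u \<otimes> k' = k' \<otimes> u" by (simp add: commutes_with_conjugates_def)
      then have "f (u \<otimes> k') = f (k' \<otimes> u)" by simp
      then show "v \<otimes> k = k \<otimes> v" using f(3,4) h'k' by (simp add: hom)
    qed
  qed
  have sq: "is_group_square G v" if uv: "aut_equiv G u v" and u: "is_group_square G u" for u v
  proof -
    obtain f where f: "f \<in> hom G G" "f u = v"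
      using uv by (auto simp: aut_equiv_def iso_def)
    obtain h where h: "h \<in> carrier G" "h \<otimes> h = u" using u by (auto simp: is_group_square_def)
    have "f h \<otimes> f h = v" using f h hom_mult[OF f(1) h(1) h(1)] by simp
    moreover have "f h \<in> carrier G" using f h by (auto simp: hom_def)
    ultimately show ?thesis by (auto simp: is_group_square_def)
  qed
  obtain f where f: "f \<in> hom G G" "bij_betw f (carrier G) (carrier G)" "f x = y" "x \<in> carrier G"
    using assms by (auto simp: aut_equiv_def iso_def)
  have one: "f z = \<one> \<longleftrightarrow> z = \<one>" if "z \<in> carrier G" for z
    using f(1,2) that hom_one[OF f(1) is_group is_group]
    by (metis bij_betw_def inj_on_eq_iff one_closed)
  have "y = \<one> \<longleftrightarrow> x = \<one>" using one f by auto
  moreover have "y \<otimes> y = \<one> \<longleftrightarrow> x \<otimes> x = \<one>"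
    using one[of "x \<otimes> x"] f by (simp add: hom_mult)
  moreover have "y \<otimes> (y \<otimes> y) = \<one> \<longleftrightarrow> x \<otimes> (x \<otimes> x) = \<one>"
    using one[of "x \<otimes> (x \<otimes> x)"] f by (simp add: hom_mult)
  moreover have "y \<otimes> (y \<otimes> (y \<otimes> (y \<otimes> y))) = \<one> \<longleftrightarrow> x \<otimes> (x \<otimes> (x \<otimes> (x \<otimes> x))) = \<one>"
    using one[of "x \<otimes> (x \<otimes> (x \<otimes> (x \<otimes> x)))"] f by (simp add: hom_mult)
  moreover have "commutes_with_conjugates G y \<longleftrightarrow> commutes_with_conjugates G x"
    "is_group_square G y \<longleftrightarrow> is_group_square G x"
    using comm sq assms aut_equiv_sym by blast+
  ultimately show ?thesis by (simp add: aut_label_def)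
qed

section \<open>Matrices with two rows\<close>

lemma gf4_neg: "- x = (x :: gf4)"
  by (cases x rule: gf4_exhaust) simp_all

lemma gf4_add_self: "x + x = (0 :: gf4)"
  by (cases x rule: gf4_exhaust) (simp_all add: zero_gf4_def)

lemma gf4_add_eq_0_iff: "x + y = 0 \<longleftrightarrow> x = (y :: gf4)"
  by (metis gf4_neg add.inverse_unique add.right_inverse)

lemma gf4_add_self_left: "x + (x + y) = (y :: gf4)"
  by (simp add: add.assoc[symmetric] gf4_add_self)

lemma gf4_diff: "x - y = x + (y :: gf4)"
  by (simp add: diff_conv_add_uminus gf4_neg del: add_uminus_conv_diff)

lemmas gf4_char2 = gf4_neg gf4_diff gf4_add_self gf4_add_self_left

lemma gf4_square_eq_1: "x * x = 1 \<Longrightarrow> x = (1 :: gf4)"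
  by (cases x rule: gf4_exhaust) (simp_all add: one_gf4_def)

instance gf4 :: finite
  by standard (simp add: UNIV_gf4)

section \<open>Matrices given by their entries or rows\<close>

definition mat2 :: "'a \<Rightarrow> 'a \<Rightarrow> 'a \<Rightarrow> 'a \<Rightarrow> 'a mat" where
  "mat2 a b c d = mat 2 2 (\<lambda>(i, j). if i = 0 then if j = 0 then a else b else if j = 0 then c else d)"

text \<open>Rows are functions on all naturals of which only the values below \<open>m\<close>
  count. Together with \<open>mat2\<close> this turns matrix identities into identities of
  scalars.\<close>

definition rows2 :: "nat \<Rightarrow> (nat \<Rightarrow> 'a) \<Rightarrow> (nat \<Rightarrow> 'a) \<Rightarrow> 'a mat" where
  "rows2 m f g = mat 2 m (\<lambda>(i, j). if i = 0 then f j else g j)"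

lemma mat2_carrier [simp]: "mat2 a b c d \<in> carrier_mat 2 2"
  by (simp add: mat2_def)

lemma rows2_carrier [simp]: "rows2 m f g \<in> carrier_mat 2 m"
  by (simp add: rows2_def)

lemma mat2_eq_iff: "mat2 a b c d = mat2 a' b' c' d' \<longleftrightarrow> a = a' \<and> b = b' \<and> c = c' \<and> d = d'"
proof
  assume "mat2 a b c d = mat2 a' b' c' d'"
  then have "mat2 a b c d $$ (i, j) = mat2 a' b' c' d' $$ (i, j)" for i j by simp
  from this[of 0 0] this[of 0 1] this[of 1 0] this[of 1 1]
  show "a = a' \<and> b = b' \<and> c = c' \<and> d = d'" by (simp add: mat2_def)
qed simp

lemma rows2_eq_iff: "rows2 m f g = rows2 m f' g' \<longleftrightarrow> (\<forall>j < m. f j = f' j \<and> g j = g' j)"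
proof
  assume eq: "rows2 m f g = rows2 m f' g'"
  show "\<forall>j < m. f j = f' j \<and> g j = g' j"
  proof (intro allI impI)
    fix j assume "j < m"
    moreover have "rows2 m f g $$ (i, j) = rows2 m f' g' $$ (i, j)" for i using eq by simp
    from this[of 0] this[of 1] show "f j = f' j \<and> g j = g' j"
      using \<open>j < m\<close> by (simp add: rows2_def)
  qed
qed (auto simp: rows2_def intro!: eq_matI)

lemma mat2_cases:
  assumes "A \<in> carrier_mat 2 2"
  obtains a b c d where "A = mat2 a b c d"
proof
  show "A = mat2 (A $$ (0,0)) (A $$ (0,1)) (A $$ (1,0)) (A $$ (1,1))"
    using assms by (auto intro!: eq_matI simp: mat2_def less_2_cases_iff)
qed

lemma rows2_cases:
  assumes "X \<in> carrier_mat 2 m"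
  obtains f g where "X = rows2 m f g"
proof
  show "X = rows2 m (\<lambda>j. X $$ (0,j)) (\<lambda>j. X $$ (1,j))"
    using assms by (auto intro!: eq_matI simp: rows2_def less_2_cases_iff)
qed

lemma one_mat2: "1\<^sub>m 2 = mat2 1 0 0 1"
  by (auto intro!: eq_matI simp: mat2_def less_2_cases_iff)

lemma mat2_mult_one [simp]:
  "1\<^sub>m 2 * mat2 a b c d = mat2 a b c d" "mat2 a b c d * 1\<^sub>m 2 = mat2 a b c (d :: 'a :: semiring_1)"
  by (rule left_mult_one_mat[OF mat2_carrier], rule right_mult_one_mat[OF mat2_carrier])

lemma zero_rows2: "0\<^sub>m 2 m = rows2 m (\<lambda>_. 0) (\<lambda>_. 0)"
  by (auto intro!: eq_matI simp: rows2_def)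

lemma add_rows2: "rows2 m f g + rows2 m f' g' = rows2 m (\<lambda>j. f j + f' j) (\<lambda>j. g j + g' j)"
  by (auto intro!: eq_matI simp: rows2_def)

lemma minus_rows2:
  "rows2 m f g - rows2 m f' g' = rows2 m (\<lambda>j. f j - f' j) (\<lambda>j. g j - g' j :: 'a :: group_add)"
  by (auto intro!: eq_matI simp: rows2_def)

lemma uminus_rows2: "- rows2 m f g = rows2 m (\<lambda>j. - f j) (\<lambda>j. - g j)"
  by (auto intro!: eq_matI simp: rows2_def)

lemma mult_mat2_rows2:
  "mat2 a b c d * rows2 m f g =
     rows2 m (\<lambda>j. a * f j + b * g j) (\<lambda>j. c * f j + d * g j :: 'a :: semiring_0)"
  by (auto intro!: eq_matI simp: rows2_def mat2_def scalar_prod_def less_2_cases_iff numeral_2_eq_2)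

lemma mult_mat2:
  "mat2 a b c d * mat2 a' b' c' d' =
     mat2 (a * a' + b * c') (a * b' + b * d') (c * a' + d * c') (c * b' + d * d' :: 'a :: semiring_0)"
  by (auto intro!: eq_matI simp: mat2_def scalar_prod_def less_2_cases_iff numeral_2_eq_2)

lemma det_mat2: "det (mat2 a b c d) = a * d - b * (c :: 'a :: comm_ring_1)"
proof -
  have "det (mat2 a b c d) = (\<Sum>j<2. mat2 a b c d $$ (0, j) * cofactor (mat2 a b c d) 0 j)"
    by (rule laplace_expansion_row) auto
  also have "\<dots> = a * cofactor (mat2 a b c d) 0 0 + b * cofactor (mat2 a b c d) 0 1"
    by (simp add: numeral_2_eq_2 mat2_def)
  also have "\<dots> = a * d - b * c"
    by (simp add: cofactor_def mat_delete_def mat2_def det_single)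
  finally show ?thesis .
qed

definition inverse_mats :: "nat \<Rightarrow> 'a :: semiring_1 mat \<Rightarrow> 'a mat \<Rightarrow> bool" where
  "inverse_mats n P P' \<longleftrightarrow> P \<in> carrier_mat n n \<and> P' \<in> carrier_mat n n \<and> P * P' = 1\<^sub>m n \<and> P' * P = 1\<^sub>m n"

lemma inverse_mats_sym: "inverse_mats n P P' \<Longrightarrow> inverse_mats n P' P"
  by (simp add: inverse_mats_def)

lemma inverse_mats_one: "inverse_mats n (1\<^sub>m n) (1\<^sub>m n)"
  by (simp add: inverse_mats_def)

lemma inverse_mats_mat2:
  fixes a b c d :: "'a :: field"
  assumes "a * d - b * c \<noteq> 0"
  obtains P' where "inverse_mats 2 (mat2 a b c d) P'"
proof -
  have "mat2 a b c d \<in> Units (ring_mat TYPE('a) 2 ())"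
    using assms by (intro det_non_zero_imp_unit) (simp_all add: det_mat2)
  then show ?thesis
    using that by (auto simp: Units_def ring_mat_def inverse_mats_def)
qed

text \<open>Row reduction of the transpose is column reduction of \<open>X\<close>. The reduced
  echelon form has two columns, hence at most two pivots: two of them give the identity block, fewer
  leave at most one nonzero row, which becomes the column \<open>(u, v)\<close>, possibly
  zero.\<close>

lemma column_reduction:
  fixes X :: "'a :: field mat"
  assumes X: "X \<in> carrier_mat 2 m" and m: "m \<ge> 2"
  obtains Q Q' where "inverse_mats m Q Q'"
    "X * Q = rows2 m (\<lambda>j. if j = 0 then 1 else 0) (\<lambda>j. if j = 1 then 1 else 0)"
  | Q Q' u v where "inverse_mats m Q Q'"
    "X * Q = rows2 m (\<lambda>j. if j = 0 then u else 0) (\<lambda>j. if j = 0 then v else 0)"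
proof -
  define E where "E = gauss_jordan_single X\<^sup>T"
  have XT: "X\<^sup>T \<in> carrier_mat m 2" using X by simp
  note gj = gauss_jordan_single[OF XT E_def[symmetric]]
  from gj(4) obtain P P' where P: "E = P * X\<^sup>T" "inverse_mats m P P'"
    by (auto simp: inverse_mats_def)
  then have Pc: "P \<in> carrier_mat m m" "P' \<in> carrier_mat m m" "P * P' = 1\<^sub>m m" "P' * P = 1\<^sub>m m"
    by (auto simp: inverse_mats_def)
  have inv: "inverse_mats m P\<^sup>T P'\<^sup>T"
    using Pc by (simp add: inverse_mats_def transpose_mult[OF Pc(1,2), symmetric] transpose_mult[OF Pc(2,1), symmetric])
  have XP: "X * P\<^sup>T = E\<^sup>T"
    unfolding P(1) using transpose_mult[OF Pc(1) XT] by simp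
  have E: "E \<in> carrier_mat m 2" by (rule gj(2))
  then have ET: "E\<^sup>T = rows2 m (\<lambda>j. E $$ (j, 0)) (\<lambda>j. E $$ (j, 1))"
    by (auto intro!: eq_matI simp: rows2_def less_2_cases_iff)
  obtain p where "pivot_fun E p 2"
    using gj(3) E by (auto simp: row_echelon_form_def)
  note p = pivot_funD[OF carrier_matD(1)[OF E] this]
  \<comment> \<open>The pivot position 2, equal to the number of columns, marks a zero row.
    Positions increase strictly until they reach it, so only the rows 0 and 1 can have a
    pivot.\<close>
  have p_step: "p j < p (Suc j) \<or> p (Suc j) = 2" if "Suc j < m" for j
    using p(3)[of j] that by auto
  have p2: "p j = 2" if "j \<ge> 2" "j < m" for j
    using that
  proof (induction j rule: dec_induct)
    case base
    then show ?case using p(1)[of 2] p_step[of 0] p_step[of 1] m by (auto simp: numeral_2_eq_2)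
  next
    case (step j)
    then show ?case using p_step[of j] p(1)[of "Suc j"] by auto
  qed
  have tail: "E $$ (j, i) = 0" if "j \<ge> 2" "j < m" "i < 2" for i j
    using p(2)[of j i] p2[of j] that by auto
  consider "p 0 = 0" "p 1 = 1" | "p 1 = 2"
    using p(1)[of 0] p(1)[of 1] p_step[of 0] m by force
  then show ?thesis
  proof cases
    case 1
    have "E $$ (j, 0) = (if j = 0 then 1 else 0)" "E $$ (j, 1) = (if j = 1 then 1 else 0)" if "j < m" for j
      using p(4,5)[of 0] p(4,5)[of 1] 1 that m by auto
    with ET XP have "X * P\<^sup>T = rows2 m (\<lambda>j. if j = 0 then 1 else 0) (\<lambda>j. if j = 1 then 1 else 0)"
      by (simp add: rows2_eq_iff)
    with inv that(1) show ?thesis by blast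
  next
    case 2
    have "E $$ (j, i) = 0" if "j \<noteq> 0" "j < m" "i < 2" for i j
      using p(2)[of 1 i] 2 tail[of j i] that m by (cases "j = 1") auto
    with ET XP have "X * P\<^sup>T = rows2 m (\<lambda>j. if j = 0 then E $$ (0,0) else 0) (\<lambda>j. if j = 0 then E $$ (0,1) else 0)"
      by (simp add: rows2_eq_iff)
    with inv that(2) show ?thesis by blast
  qed
qed

section \<open>Automorphisms of the semidirect product\<close>

lemma carrier_SL2_ltimes_mat:
  "(A, X) \<in> carrier (SL2_ltimes_mat m) \<longleftrightarrow> A \<in> carrier_mat 2 2 \<and> det A = 1 \<and> X \<in> carrier_mat 2 m"
  by (simp add: SL2_ltimes_mat_def semidirect_product_def special_linear_group_def module_mat_def)

lemma mult_SL2_ltimes_mat: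
  "(A, X) \<otimes>\<^bsub>SL2_ltimes_mat m\<^esub> (B, Y) = (A * B, X + A * Y)"
  by (simp add: SL2_ltimes_mat_def semidirect_product_def special_linear_group_def module_mat_def)

lemma one_SL2_ltimes_mat: "\<one>\<^bsub>SL2_ltimes_mat m\<^esub> = (1\<^sub>m 2, 0\<^sub>m 2 m)"
  by (simp add: SL2_ltimes_mat_def semidirect_product_def special_linear_group_def module_mat_def)

lemma iso_byWitness:
  assumes "f \<in> hom G H" "g \<in> hom H G"
    and "\<And>x. x \<in> carrier G \<Longrightarrow> g (f x) = x" "\<And>y. y \<in> carrier H \<Longrightarrow> f (g y) = y"
  shows "f \<in> iso G H"
proof -
  have "bij_betw f (carrier G) (carrier H)"
    by (rule bij_betw_byWitness[where f' = g]) (use assms in \<open>auto simp: hom_def\<close>)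
  with assms(1) show ?thesis by (simp add: iso_def)
qed

lemma inverse_mats_cancel:
  assumes "inverse_mats n P P'" "Z \<in> carrier_mat n k"
  shows "P' * (P * Z) = Z"
  using assms assoc_mult_mat[of P' n n P n Z k] by (simp add: inverse_mats_def)

text \<open>The inner \<open>P' * P\<close> cancels in \<open>P A P' (P Y Q) = P (A Y) Q\<close>,
  and multiplication by \<open>Q\<close> from the right commutes with the action from the
  left.\<close>

lemma mat_mult_hom:
  fixes P P' :: "'a :: field mat"
  assumes P: "inverse_mats 2 P P'" and Q: "Q \<in> carrier_mat m m"
  shows "(\<lambda>(A, X). (P * A * P', P * X * Q)) \<in> hom (SL2_ltimes_mat m) (SL2_ltimes_mat m)"
proof (rule homI; clarify)
  fix A X :: "'a mat" assume "(A, X) \<in> carrier (SL2_ltimes_mat m)"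
  then have A: "A \<in> carrier_mat 2 2" "det A = 1" and X: "X \<in> carrier_mat 2 m"
    by (auto simp: carrier_SL2_ltimes_mat)
  have Pc: "P \<in> carrier_mat 2 2" "P' \<in> carrier_mat 2 2" and PP: "P * P' = 1\<^sub>m 2"
    using P by (auto simp: inverse_mats_def)
  have "det P * det P' = 1"
    using PP det_mult[OF Pc] by simp
  then have "det (P * A * P') = 1"
    using A Pc by (simp add: det_mult[of _ 2])
  then show "(P * A * P', P * X * Q) \<in> carrier (SL2_ltimes_mat m)"
    using A Pc X Q by (simp add: carrier_SL2_ltimes_mat)
  fix B Y :: "'a mat" assume "(B, Y) \<in> carrier (SL2_ltimes_mat m)"
  then have B: "B \<in> carrier_mat 2 2" and Y: "Y \<in> carrier_mat 2 m"
    by (auto simp: carrier_SL2_ltimes_mat)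
  note assoc = assoc_mult_mat[of _ 2 2 _ 2 _ 2] assoc_mult_mat[of _ 2 2 _ 2 _ m]
    assoc_mult_mat[of _ 2 2 _ m _ m]
  have "P * (A * B) * P' = P * A * P' * (P * B * P')"
    using Pc A B by (simp add: assoc inverse_mats_cancel[OF P, of _ 2])
  moreover have "P * (X + A * Y) * Q = P * X * Q + P * A * P' * (P * Y * Q)"
    using Pc A X Y Q
    by (simp add: assoc inverse_mats_cancel[OF P, of _ m] mult_add_distrib_mat[of _ 2 2 _ m]
        add_mult_distrib_mat[of _ 2 m _ _ m])
  ultimately show "(case (A, X) \<otimes>\<^bsub>SL2_ltimes_mat m\<^esub> (B, Y) of (A, X) \<Rightarrow> (P * A * P', P * X * Q)) =
      (P * A * P', P * X * Q) \<otimes>\<^bsub>SL2_ltimes_mat m\<^esub> (P * B * P', P * Y * Q)"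
    by (simp add: mult_SL2_ltimes_mat)
qed

lemma aut_equiv_linear:
  fixes P P' :: "'a :: field mat"
  assumes P: "inverse_mats 2 P P'" and Q: "inverse_mats m Q Q'"
    and x: "(A, X) \<in> carrier (SL2_ltimes_mat m)"
  shows "aut_equiv (SL2_ltimes_mat m) (A, X) (P * A * P', P * X * Q)"
proof -
  \<comment> \<open>Stated for arbitrary pairs, so that exchanging \<open>P\<close> with
    \<open>P'\<close> and \<open>Q\<close> with \<open>Q'\<close> gives the composite in the other
    order as well.\<close>
  have inv: "P' * (P * A * P') * P = A \<and> P' * (P * X * Q) * Q' = X"
    if "inverse_mats 2 P P'" "inverse_mats m Q Q'" "(A, X) \<in> carrier (SL2_ltimes_mat m)"
    for P P' Q Q' A X :: "'a mat"
  proof -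
    have c: "P \<in> carrier_mat 2 2" "P' \<in> carrier_mat 2 2" "P' * P = 1\<^sub>m 2"
      "Q \<in> carrier_mat m m" "Q' \<in> carrier_mat m m" "Q * Q' = 1\<^sub>m m"
      "A \<in> carrier_mat 2 2" "X \<in> carrier_mat 2 m"
      using that by (auto simp: inverse_mats_def carrier_SL2_ltimes_mat)
    have "P' * (P * A * P') * P = P' * (P * A)"
      using c by (simp add: assoc_mult_mat[of _ 2 2 _ 2 _ 2])
    moreover have "P' * (P * X * Q) * Q' = P' * (P * X)"
      using c by (simp add: assoc_mult_mat[of _ 2 2 _ m _ m] assoc_mult_mat[of _ 2 m _ m _ m])
    ultimately show ?thesis
      using c inverse_mats_cancel[OF that(1)] by simp
  qed
  have "(\<lambda>(A, X). (P * A * P', P * X * Q)) \<in> iso (SL2_ltimes_mat m) (SL2_ltimes_mat m)"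
  proof (rule iso_byWitness)
    show "(\<lambda>(A, X). (P' * A * P, P' * X * Q')) \<in> hom (SL2_ltimes_mat m) (SL2_ltimes_mat m)"
      using mat_mult_hom[OF inverse_mats_sym[OF P]] Q by (simp add: inverse_mats_def)
  qed (use mat_mult_hom[OF P] inv[OF P Q] inv[OF P[THEN inverse_mats_sym] Q[THEN inverse_mats_sym]]
      Q in \<open>auto simp: inverse_mats_def\<close>)
  from aut_equivI[OF this x] show ?thesis by simp
qed

text \<open>Conjugation by \<open>(1, Y)\<close>.\<close>

lemma aut_equiv_conj_translation:
  fixes Y :: "'a :: field mat"
  assumes Y: "Y \<in> carrier_mat 2 m" and x: "(A, X) \<in> carrier (SL2_ltimes_mat m)"
  shows "aut_equiv (SL2_ltimes_mat m) (A, X) (A, X + (Y - A * Y))"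
proof -
  let ?G = "SL2_ltimes_mat m :: ('a mat \<times> 'a mat) monoid"
  have hom: "(\<lambda>(A, X). (A, X + (Y - A * Y))) \<in> hom ?G ?G" if Y: "Y \<in> carrier_mat 2 m" for Y :: "'a mat"
  proof (rule homI; clarify)
    fix A X :: "'a mat" assume ax: "(A, X) \<in> carrier ?G"
    show "(A, X + (Y - A * Y)) \<in> carrier ?G"
      using Y ax by (auto simp: carrier_SL2_ltimes_mat)
    fix B Z :: "'a mat" assume "(B, Z) \<in> carrier ?G"
    with ax Y show "(case (A, X) \<otimes>\<^bsub>?G\<^esub> (B, Z) of (A, X) \<Rightarrow> (A, X + (Y - A * Y))) =
       (A, X + (Y - A * Y)) \<otimes>\<^bsub>?G\<^esub> (B, Z + (Y - B * Y))"
      unfolding carrier_SL2_ltimes_mat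
      by (elim conjE mat2_cases rows2_cases)
        (simp add: mult_SL2_ltimes_mat mult_mat2 mult_mat2_rows2 add_rows2 minus_rows2
          rows2_eq_iff algebra_simps)
  qed
  have inv: "X + (Y - A * Y) + ((- Y) - A * (- Y)) = X" "X + ((- Y) - A * (- Y)) + (Y - A * Y) = X"
    if "(A, X) \<in> carrier ?G" for A X :: "'a mat"
    using Y that unfolding carrier_SL2_ltimes_mat
    by (elim conjE mat2_cases rows2_cases,
        simp add: mult_mat2_rows2 add_rows2 minus_rows2 uminus_rows2 rows2_eq_iff algebra_simps)+
  have "(\<lambda>(A, X). (A, X + (Y - A * Y))) \<in> iso ?G ?G"
    by (rule iso_byWitness[OF hom hom, of _ "- Y"]) (use Y inv in auto)
  from aut_equivI[OF this x] show ?thesis by simp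
qed

section \<open>The Frobenius automorphism\<close>

lemma gf4_frobenius: "comm_ring_hom (\<lambda>x :: gf4. x * x)"
proof
  fix x y :: gf4
  show "(x + y) * (x + y) = x * x + y * y"
    by (cases x rule: gf4_exhaust; cases y rule: gf4_exhaust) simp_all
qed (simp_all add: ac_simps)

lemma gf4_frobenius_involution: "x * x * (x * x) = (x :: gf4)"
  by (cases x rule: gf4_exhaust) simp_all

text \<open>Being a ring homomorphism, the Frobenius applied entrywise respects determinants, sums
  and products of matrices; it is its own inverse since \<open>x^4 = x\<close>.\<close>

lemma aut_equiv_frobenius:
  assumes x: "(A, X) \<in> carrier (SL2_ltimes_mat m)"
  shows "aut_equiv (SL2_ltimes_mat m) (A, X) (map_mat (\<lambda>x :: gf4. x * x) A, map_mat (\<lambda>x. x * x) X)"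
proof -
  let ?G = "SL2_ltimes_mat m :: (gf4 mat \<times> gf4 mat) monoid"
  let ?\<sigma> = "map_mat (\<lambda>x :: gf4. x * x)"
  interpret comm_ring_hom "\<lambda>x :: gf4. x * x" by (rule gf4_frobenius)
  have hom: "map_prod ?\<sigma> ?\<sigma> \<in> hom ?G ?G"
  proof (rule homI; clarify)
    fix A X :: "gf4 mat" assume ax: "(A, X) \<in> carrier ?G"
    then show "map_prod ?\<sigma> ?\<sigma> (A, X) \<in> carrier ?G"
      by (simp add: carrier_SL2_ltimes_mat)
    fix B Y :: "gf4 mat" assume b: "(B, Y) \<in> carrier ?G"
    have "?\<sigma> (A * B) = ?\<sigma> A * ?\<sigma> B" "?\<sigma> (A * Y) = ?\<sigma> A * ?\<sigma> Y"
      using ax b mat_hom_mult[of A 2 2] by (auto simp: carrier_SL2_ltimes_mat)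
    moreover have "?\<sigma> (U + V) = ?\<sigma> U + ?\<sigma> V" if "U \<in> carrier_mat 2 m" "V \<in> carrier_mat 2 m" for U V
      using that by (intro eq_matI) (auto simp: hom_add)
    from this[of X "A * Y"] have "?\<sigma> (X + A * Y) = ?\<sigma> X + ?\<sigma> (A * Y)"
      using ax b mult_carrier_mat[of A 2 2 Y m] by (simp add: carrier_SL2_ltimes_mat)
    ultimately show "map_prod ?\<sigma> ?\<sigma> ((A, X) \<otimes>\<^bsub>?G\<^esub> (B, Y)) =
        map_prod ?\<sigma> ?\<sigma> (A, X) \<otimes>\<^bsub>?G\<^esub> map_prod ?\<sigma> ?\<sigma> (B, Y)"
      by (simp add: mult_SL2_ltimes_mat)
  qed
  have "?\<sigma> (?\<sigma> Z) = Z" for Z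
    by (auto intro!: eq_matI simp: gf4_frobenius_involution)
  then have "map_prod ?\<sigma> ?\<sigma> \<in> iso ?G ?G"
    by (intro iso_byWitness[OF hom hom]) auto
  from aut_equivI[OF this x] show ?thesis by simp
qed

section \<open>Normal forms\<close>

abbreviation gf4_gen :: gf4 where
  "gf4_gen \<equiv> GF4 0 1"

text \<open>The companion matrix of \<open>x^2 + t x + 1\<close>; its determinant is
  \<open>-1 = 1\<close> in characteristic two.\<close>

abbreviation companion :: "gf4 \<Rightarrow> gf4 mat" where
  "companion t \<equiv> mat2 0 1 1 t"

abbreviation unit_row :: "nat \<Rightarrow> nat \<Rightarrow> gf4" where
  "unit_row i \<equiv> \<lambda>j. if j = i then 1 else 0"

text \<open>A non-scalar matrix of size two has a cyclic vector \<open>v\<close>, and in the basis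
  \<open>v\<close>, \<open>A v\<close> it becomes the companion matrix by Cayley-Hamilton. The
  identity is the only scalar matrix of determinant 1, because \<open>x * x = 1\<close> forces
  \<open>x = 1\<close> here.\<close>

lemma aut_equiv_companion:
  fixes A X :: "gf4 mat"
  assumes x: "(A, X) \<in> carrier (SL2_ltimes_mat m)" and A1: "A \<noteq> 1\<^sub>m 2"
  obtains t Y where "aut_equiv (SL2_ltimes_mat m) (A, X) (companion t, Y)"
proof -
  have A: "A \<in> carrier_mat 2 2" "det A = 1" and X: "X \<in> carrier_mat 2 m"
    using x by (auto simp: carrier_SL2_ltimes_mat)
  obtain a b c d where abcd: "A = mat2 a b c d" by (rule mat2_cases[OF A(1)])
  have "a * d + b * c = 1"
    using A(2) by (simp add: abcd det_mat2 gf4_char2)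
  then have bc: "b * c = 1 + a * d"
    by (metis gf4_add_self_left add.commute)
  text \<open>The columns of \<open>P\<close> are a cyclic vector \<open>v\<close> of \<open>A\<close> and \<open>A v\<close>.\<close>
  have "\<exists>p q r s. p * s - q * r \<noteq> 0 \<and> A * mat2 p q r s = mat2 p q r s * companion (a + d)"
  \<comment> \<open>The cyclic vector is the first unit vector if \<open>c\<close> is nonzero, the
    second one if \<open>c = 0\<close> and \<open>b\<close> is nonzero, and \<open>(1, 1)\<close> if
    \<open>A\<close> is diagonal; in that last case the diagonal entries must differ.\<close>
  proof (cases "c = 0")
    case False
    have "A * mat2 1 a 0 c = mat2 1 a 0 c * companion (a + d)"
      by (simp add: abcd mult_mat2 mat2_eq_iff bc algebra_simps)
    with False show ?thesis by (intro exI[of _ 1] exI[of _ a] exI[of _ 0] exI[of _ c]) simp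
  next
    case c: True
    show ?thesis
    proof (cases "b = 0")
      case False
      have "A * mat2 0 b 1 d = mat2 0 b 1 d * companion (a + d)"
        using bc by (simp add: abcd mult_mat2 mat2_eq_iff algebra_simps)
      with False show ?thesis by (intro exI[of _ 0] exI[of _ b] exI[of _ 1] exI[of _ d]) simp
    next
      case b: True
      with bc have ad: "a * d = 1"
        by (simp add: gf4_add_eq_0_iff)
      have "a \<noteq> d"
      proof
        assume "a = d"
        with ad have "a = 1" "d = 1" by (auto intro: gf4_square_eq_1)
        with A1 b c show False by (simp add: abcd one_mat2)
      qed
      moreover have "A * mat2 1 a 1 d = mat2 1 a 1 d * companion (a + d)"
        using ad by (simp add: abcd b c mult_mat2 mat2_eq_iff algebra_simps gf4_char2)
      ultimately show ?thesis by (intro exI[of _ 1] exI[of _ a] exI[of _ 1] exI[of _ d]) simp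
    qed
  qed
  then obtain P where AP: "A * P = P * companion (a + d)" and "\<exists>P'. inverse_mats 2 P P'"
    by (metis inverse_mats_mat2)
  then obtain P' where P: "inverse_mats 2 P P'" by blast
  have "P' * A * P = P' * (A * P)"
    using A(1) P by (intro assoc_mult_mat) (auto simp: inverse_mats_def)
  also have "\<dots> = companion (a + d)"
    unfolding AP by (rule inverse_mats_cancel[OF P mat2_carrier])
  finally show ?thesis
    using that aut_equiv_linear[OF inverse_mats_sym[OF P] inverse_mats_one x] by metis
qed

lemma aut_equiv_companion_nonzero_trace:
  fixes X :: "gf4 mat"
  assumes x: "(companion t, X) \<in> carrier (SL2_ltimes_mat m)" and t: "t \<noteq> 0"
  shows "aut_equiv (SL2_ltimes_mat m) (companion t, X) (companion t, 0\<^sub>m 2 m)"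
proof -
  have "X \<in> carrier_mat 2 m" using x by (simp add: carrier_SL2_ltimes_mat)
  then obtain f g where X: "X = rows2 m f g" by (rule rows2_cases)
  \<comment> \<open>With \<open>f + k\<close> and \<open>k\<close> as the rows of \<open>Y\<close>,
    the first row of \<open>(1 + companion t) Y = X\<close> holds automatically and the second
    becomes \<open>t k = f + g\<close>.\<close>
  define k where "k j = inverse t * (f j + g j)" for j
  have k: "t * k j = f j + g j" for j using t by (simp add: k_def)
  have "X + (rows2 m (\<lambda>j. f j + k j) k - companion t * rows2 m (\<lambda>j. f j + k j) k) = 0\<^sub>m 2 m"
    by (simp add: X zero_rows2 mult_mat2_rows2 add_rows2 minus_rows2 rows2_eq_iff k gf4_char2 ac_simps)
  with aut_equiv_conj_translation[OF rows2_carrier x] show ?thesis by metis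
qed

lemma aut_equiv_companion_zero_trace:
  fixes X :: "gf4 mat"
  assumes x: "(companion 0, X) \<in> carrier (SL2_ltimes_mat m)" and m: "m \<ge> 2"
  shows "aut_equiv (SL2_ltimes_mat m) (companion 0, X) (companion 0, 0\<^sub>m 2 m) \<or>
    aut_equiv (SL2_ltimes_mat m) (companion 0, X) (companion 0, rows2 m (unit_row 0) (\<lambda>_. 0))"
proof -
  let ?G = "SL2_ltimes_mat m :: (gf4 mat \<times> gf4 mat) monoid"
  have "X \<in> carrier_mat 2 m" using x by (simp add: carrier_SL2_ltimes_mat)
  then obtain f g where X: "X = rows2 m f g" by (rule rows2_cases)
  \<comment> \<open>For trace zero, \<open>1 - A\<close> is the all-ones matrix, whose image
    consists of the matrices with two equal rows. Adding \<open>g\<close> to both rows of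
    \<open>X\<close> clears the second one.\<close>
  define Z where "Z = rows2 m (\<lambda>j. f j + g j) (\<lambda>_. 0)"
  have "X + (rows2 m g (\<lambda>_. 0) - companion 0 * rows2 m g (\<lambda>_. 0)) = Z"
    by (simp add: X Z_def mult_mat2_rows2 add_rows2 minus_rows2 rows2_eq_iff gf4_char2 ac_simps)
  with aut_equiv_conj_translation[OF rows2_carrier x]
  have xZ: "aut_equiv ?G (companion 0, X) (companion 0, Z)" by metis
  have z: "(companion 0, Z) \<in> carrier ?G" by (rule aut_equiv_in_carrier[OF xZ])
  have Zc: "Z \<in> carrier_mat 2 m" by (simp add: Z_def)
  have ZQ: "aut_equiv ?G (companion 0, X) (companion 0, Z * Q)" if "inverse_mats m Q Q'" for Q Q'
    using aut_equiv_trans[OF xZ] aut_equiv_linear[OF inverse_mats_one that z] Zc by simp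
  \<comment> \<open>The matrix \<open>mat2 1 0 0 0\<close> keeps the first row and kills the second.
    It fixes \<open>Z\<close>, hence every \<open>Z * Q\<close>, which rules out the identity block
    and forces \<open>v = 0\<close> in the other case.\<close>
  have proj: "mat2 1 0 0 0 * (Z * Q) = Z * Q" if "Q \<in> carrier_mat m m" for Q
  proof -
    have "mat2 1 0 0 0 * Z = Z"
      by (simp add: Z_def mult_mat2_rows2)
    then show ?thesis using assoc_mult_mat[OF mat2_carrier Zc that, of 1 0 0 0] by simp
  qed
  show ?thesis
  proof (cases rule: column_reduction[OF Zc m])
    case (1 Q Q')
    then have "(1 :: gf4) = 0"
      using proj[of Q] m by (auto simp: inverse_mats_def mult_mat2_rows2 rows2_eq_iff dest: spec[of _ 1])
    then show ?thesis by simp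
  next
    case (2 Q Q' u v)
    have "v = 0"
      using proj[of Q] 2 m by (auto simp: inverse_mats_def mult_mat2_rows2 rows2_eq_iff dest: spec[of _ 0])
    with ZQ[OF 2(1)] 2(2) have *: "aut_equiv ?G (companion 0, X)
        (companion 0, rows2 m (\<lambda>j. if j = 0 then u else 0) (\<lambda>_. 0))"
      by (simp cong: if_cong)
    show ?thesis
    proof (cases "u = 0")
      case True
      with * show ?thesis by (simp add: zero_rows2 cong: if_cong)
    next
      case False
      \<comment> \<open>A scalar matrix commutes with \<open>companion 0\<close>, so it rescales the
        row and leaves the first component alone.\<close>
      let ?P = "mat2 (inverse u) 0 0 (inverse u)" and ?P' = "mat2 u 0 0 u"
      have inv: "inverse_mats 2 ?P ?P'"
        using False by (simp add: inverse_mats_def mult_mat2 one_mat2)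
      have scale: "?P * rows2 m (\<lambda>j. if j = 0 then u else 0) (\<lambda>_. 0) = rows2 m (unit_row 0) (\<lambda>_. 0)"
        using False by (simp add: mult_mat2_rows2 rows2_eq_iff)
      from aut_equiv_linear[OF inv inverse_mats_one aut_equiv_in_carrier[OF *]]
      have "aut_equiv ?G (companion 0, rows2 m (\<lambda>j. if j = 0 then u else 0) (\<lambda>_. 0))
          (companion 0, rows2 m (unit_row 0) (\<lambda>_. 0))"
        using False scale by (simp add: mult_mat2 right_mult_one_mat[OF rows2_carrier])
      from aut_equiv_trans[OF * this] show ?thesis by simp
    qed
  qed
qed

text \<open>Conjugation fixes the identity matrix, so row and column operations on \<open>X\<close>
  are both available without changing the first component.\<close>

lemma aut_equiv_translation_normal_form:
  fixes X :: "gf4 mat"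
  assumes x: "(1\<^sub>m 2, X) \<in> carrier (SL2_ltimes_mat m)" and m: "m \<ge> 2"
  shows "\<exists>Y \<in> {0\<^sub>m 2 m, rows2 m (unit_row 0) (\<lambda>_. 0), rows2 m (unit_row 0) (unit_row 1)}.
    aut_equiv (SL2_ltimes_mat m) (1\<^sub>m 2, X) (1\<^sub>m 2, Y)"
proof -
  let ?G = "SL2_ltimes_mat m :: (gf4 mat \<times> gf4 mat) monoid"
  have X: "X \<in> carrier_mat 2 m" using x by (simp add: carrier_SL2_ltimes_mat)
  have XQ: "aut_equiv ?G (1\<^sub>m 2, X) (1\<^sub>m 2, X * Q)" if "inverse_mats m Q Q'" for Q Q'
    using aut_equiv_linear[OF inverse_mats_one that x] X by simp
  show ?thesis
  proof (cases rule: column_reduction[OF X m])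
    case (1 Q Q')
    with XQ[OF 1(1)] show ?thesis by simp
  next
    case (2 Q Q' u v)
    show ?thesis
    proof (cases "u = 0 \<and> v = 0")
      case True
      with XQ[OF 2(1)] 2(2) show ?thesis by (simp add: zero_rows2 cong: if_cong)
    next
      case False
      \<comment> \<open>The nonzero column \<open>(u, v)\<close> is completed to an invertible
        matrix, whose inverse maps it to the first unit vector.\<close>
      then have "\<exists>p q. u * q - p * v \<noteq> 0"
        by (metis diff_zero mult_1 mult_1_right mult_zero_left mult_zero_right diff_0 neg_equal_0_iff_equal)
      then obtain p q P' where P: "inverse_mats 2 (mat2 u p v q) P'"
        by (metis inverse_mats_mat2)
      let ?E = "rows2 m (unit_row 0) (\<lambda>_. 0)"
      have "X * Q = mat2 u p v q * ?E"
        by (simp add: 2(2) mult_mat2_rows2 rows2_eq_iff)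
      then have "P' * (X * Q) = ?E"
        using inverse_mats_cancel[OF P rows2_carrier] by simp
      moreover have "P' * 1\<^sub>m 2 * mat2 u p v q = 1\<^sub>m 2" "P' * (X * Q) * 1\<^sub>m m = P' * (X * Q)"
        using P X 2(1) by (auto simp: inverse_mats_def)
      ultimately have "aut_equiv ?G (1\<^sub>m 2, X * Q) (1\<^sub>m 2, ?E)"
        using aut_equiv_linear[OF inverse_mats_sym[OF P] inverse_mats_one
            aut_equiv_in_carrier[OF XQ[OF 2(1)]]] by simp
      then show ?thesis using aut_equiv_trans[OF XQ[OF 2(1)]] by blast
    qed
  qed
qed

definition representatives :: "nat \<Rightarrow> (gf4 mat \<times> gf4 mat) list" where
  "representatives m =
    [(1\<^sub>m 2, 0\<^sub>m 2 m),
     (1\<^sub>m 2, rows2 m (unit_row 0) (\<lambda>_. 0)),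
     (1\<^sub>m 2, rows2 m (unit_row 0) (unit_row 1)),
     (companion 0, 0\<^sub>m 2 m),
     (companion 0, rows2 m (unit_row 0) (\<lambda>_. 0)),
     (companion 1, 0\<^sub>m 2 m),
     (companion gf4_gen, 0\<^sub>m 2 m)]"

lemma aut_equiv_representative:
  assumes x: "x \<in> carrier (SL2_ltimes_mat m)" and m: "m \<ge> 2"
  shows "\<exists>r \<in> set (representatives m). aut_equiv (SL2_ltimes_mat m) x r"
proof -
  let ?G = "SL2_ltimes_mat m :: (gf4 mat \<times> gf4 mat) monoid"
  obtain A X where AX: "x = (A, X)" by (cases x)
  show ?thesis
  proof (cases "A = 1\<^sub>m 2")
    case True
    with aut_equiv_translation_normal_form[of X m] x m AX show ?thesis
      by (auto simp: representatives_def)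
  next
    case False
    obtain t Y where tY: "aut_equiv ?G x (companion t, Y)"
      using aut_equiv_companion[OF _ False] x AX by metis
    note Y = aut_equiv_in_carrier[OF tY]
    have "\<exists>r \<in> set (representatives m). aut_equiv ?G (companion t, Y) r"
    proof (cases "t = 0")
      case True
      then show ?thesis using aut_equiv_companion_zero_trace[of Y m] Y m
        by (auto simp: representatives_def)
    next
      case False
      note t0 = aut_equiv_companion_nonzero_trace[OF Y False]
      show ?thesis
      proof (cases "t = 1 \<or> t = gf4_gen")
        case True
        with t0 show ?thesis by (auto simp: representatives_def)
      next
        case neither: False
        with False have t: "t = GF4 1 1"
          by (cases t rule: gf4_exhaust) (auto simp: zero_gf4_def one_gf4_def)
        \<comment> \<open>The one remaining trace is the square of \<open>gf4_gen\<close>; squaring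
          it once more gives \<open>gf4_gen\<close>, by \<open>x^4 = x\<close>. The second component
          has been made zero already and stays so.\<close>
        have "map_mat (\<lambda>x. x * x) (companion t) = companion gf4_gen"
          by (auto intro!: eq_matI simp: mat2_def t less_2_cases_iff)
        moreover have "map_mat (\<lambda>x. x * x) (0\<^sub>m 2 m) = (0\<^sub>m 2 m :: gf4 mat)"
          by (auto intro!: eq_matI)
        ultimately have "aut_equiv ?G (companion t, 0\<^sub>m 2 m) (companion gf4_gen, 0\<^sub>m 2 m)"
          using aut_equiv_frobenius[OF aut_equiv_in_carrier[OF t0]] by simp
        then show ?thesis
          using aut_equiv_trans[OF t0] by (auto simp: representatives_def)
      qed
    qed
    then show ?thesis using aut_equiv_trans[OF tY] by blast
  qed
qed

section \<open>Distinguishing the normal forms\<close>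

text \<open>The translations form an abelian normal subgroup: comparing first components and
  cancelling \<open>B\<close> shows that any conjugate \<open>k\<close> is a translation
  too.\<close>

lemma commutes_with_conjugates_translation:
  fixes X :: "gf4 mat"
  assumes X: "X \<in> carrier_mat 2 m"
  shows "commutes_with_conjugates (SL2_ltimes_mat m) (1\<^sub>m 2, X)"
  unfolding commutes_with_conjugates_def
proof (intro ballI impI)
  let ?G = "SL2_ltimes_mat m :: (gf4 mat \<times> gf4 mat) monoid"
  fix h k assume h: "h \<in> carrier ?G" and k: "k \<in> carrier ?G"
    and hk: "h \<otimes>\<^bsub>?G\<^esub> (1\<^sub>m 2, X) = k \<otimes>\<^bsub>?G\<^esub> h"
  obtain B Y C Z where hk_eq: "h = (B, Y)" "k = (C, Z)" by (cases h; cases k)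
  with h k have c: "B \<in> carrier_mat 2 2" "det B = 1" "C \<in> carrier_mat 2 2" "Z \<in> carrier_mat 2 m"
    by (auto simp: carrier_SL2_ltimes_mat)
  then have BU: "B \<in> Units (ring_mat TYPE(gf4) 2 ())"
    by (intro det_non_zero_imp_unit) simp_all
  then obtain B' where B': "B' \<in> carrier_mat 2 2" "B * B' = 1\<^sub>m 2"
    by (auto simp: Units_def ring_mat_def)
  have "B = C * B"
    using hk c(1) by (simp add: hk_eq mult_SL2_ltimes_mat)
  then have "B * B' = C * (B * B')"
    using assoc_mult_mat[OF c(3,1) B'(1)] by simp
  then have "C = 1\<^sub>m 2" using B' c(3) by simp
  then show "(1\<^sub>m 2, X) \<otimes>\<^bsub>?G\<^esub> k = k \<otimes>\<^bsub>?G\<^esub> (1\<^sub>m 2, X)"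
    using X c(4) comm_add_mat[OF X c(4)] by (simp add: hk_eq mult_SL2_ltimes_mat)
qed

text \<open>Conjugation by an upper unitriangular matrix turns the swap \<open>companion 0\<close>
  into a lower unitriangular one, and these two do not commute.\<close>

lemma not_commutes_with_conjugates_companion:
  "\<not> commutes_with_conjugates (SL2_ltimes_mat m) (companion 0, 0\<^sub>m 2 m)"
proof
  let ?G = "SL2_ltimes_mat m :: (gf4 mat \<times> gf4 mat) monoid"
  let ?h = "(mat2 1 1 0 1, 0\<^sub>m 2 m)" and ?k = "(mat2 1 0 1 1, 0\<^sub>m 2 m)"
  assume "commutes_with_conjugates ?G (companion 0, 0\<^sub>m 2 m)"
  moreover have "?h \<in> carrier ?G" "?k \<in> carrier ?G"
    by (simp_all add: carrier_SL2_ltimes_mat det_mat2)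
  moreover have "?h \<otimes>\<^bsub>?G\<^esub> (companion 0, 0\<^sub>m 2 m) = ?k \<otimes>\<^bsub>?G\<^esub> ?h"
    by (simp add: mult_SL2_ltimes_mat mult_mat2 mat2_eq_iff gf4_char2 zero_rows2 mult_mat2_rows2)
  ultimately have "(companion 0, 0\<^sub>m 2 m) \<otimes>\<^bsub>?G\<^esub> ?k = ?k \<otimes>\<^bsub>?G\<^esub> (companion 0, 0\<^sub>m 2 m)"
    unfolding commutes_with_conjugates_def by blast
  then show False
    by (simp add: mult_SL2_ltimes_mat mult_mat2 mat2_eq_iff)
qed

lemma is_group_square_rank_1:
  "is_group_square (SL2_ltimes_mat m) (1\<^sub>m 2, rows2 m f (\<lambda>_. 0 :: gf4))"
  unfolding is_group_square_def
proof (rule bexI)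
  \<comment> \<open>The transvection squares to 1, and 1 plus the transvection moves the second row
    \<open>f\<close> into the first row and leaves zero below.\<close>
  let ?h = "(mat2 1 1 0 1, rows2 m (\<lambda>_. 0) f)"
  show "?h \<in> carrier (SL2_ltimes_mat m)"
    by (simp add: carrier_SL2_ltimes_mat det_mat2)
  show "?h \<otimes>\<^bsub>SL2_ltimes_mat m\<^esub> ?h = (1\<^sub>m 2, rows2 m f (\<lambda>_. 0))"
    by (simp add: mult_SL2_ltimes_mat mult_mat2 mult_mat2_rows2 add_rows2 one_mat2 gf4_char2)
qed

text \<open>If \<open>(B, Y)\<close> squares to \<open>(1, X)\<close>, then \<open>N = 1 + B\<close> satisfies \<open>N\<^sup>2 = 0\<close> and \<open>N Y = X\<close>,
  so \<open>N X = 0\<close>.\<close>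

lemma not_is_group_square_rank_2:
  assumes m: "m \<ge> 2"
  shows "\<not> is_group_square (SL2_ltimes_mat m) (1\<^sub>m 2, rows2 m (unit_row 0) (unit_row 1))"
proof
  let ?G = "SL2_ltimes_mat m :: (gf4 mat \<times> gf4 mat) monoid"
  assume "is_group_square ?G (1\<^sub>m 2, rows2 m (unit_row 0) (unit_row 1))"
  then obtain B Y where BY: "(B, Y) \<in> carrier ?G"
    and sq: "(B, Y) \<otimes>\<^bsub>?G\<^esub> (B, Y) = (1\<^sub>m 2, rows2 m (unit_row 0) (unit_row 1))"
    by (auto simp: is_group_square_def)
  from BY obtain a b c d where B: "B = mat2 a b c d"
    by (auto simp: carrier_SL2_ltimes_mat elim: mat2_cases)
  from BY obtain f g where Y: "Y = rows2 m f g"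
    by (auto simp: carrier_SL2_ltimes_mat elim: rows2_cases)
  have N2: "a * a + b * c = 1" "a * b + b * d = 0"
    using sq by (auto simp: B Y mult_SL2_ltimes_mat mult_mat2 one_mat2 mat2_eq_iff)
  have "f j + (a * f j + b * g j) = unit_row 0 j \<and> g j + (c * f j + d * g j) = unit_row 1 j"
    if "j < m" for j
    using sq that
    by (auto simp: B Y mult_SL2_ltimes_mat mult_mat2_rows2 add_rows2 rows2_eq_iff)
  from this[of 0] this[of 1] m
  have N: "f 0 + (a * f 0 + b * g 0) = 1" "g 0 + (c * f 0 + d * g 0) = 0"
    "f 1 + (a * f 1 + b * g 1) = 0" "g 1 + (c * f 1 + d * g 1) = 1"
    by simp_all
  have N_N: "(1 + a) * (x + (a * x + b * y)) + b * (y + (c * x + d * y)) = 0" for x y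
  proof -
    have "(1 + a) * (x + (a * x + b * y)) + b * (y + (c * x + d * y)) =
        (1 + (a * a + b * c)) * x + (a * b + b * d) * y"
      by (simp add: algebra_simps gf4_char2)
    then show ?thesis by (simp add: N2 gf4_char2)
  qed
  \<comment> \<open>The columns 0 and 1 of \<open>X = (1 + B) Y\<close> are the unit vectors, so
    \<open>N_N\<close> reads off the two entries in the first row of \<open>1 + B\<close>. Both
    vanish, whereas \<open>N(1)\<close> needs a nonzero first row.\<close>
  have "1 + a = 0" "b = 0"
    using N_N[of "f 0" "g 0"] N_N[of "f 1" "g 1"]
    by (simp_all only: N mult_zero_right mult_1_right add_0_left add_0_right)
  then have "a = 1" "b = 0"
    by (simp_all add: gf4_add_eq_0_iff)
  with N(1) show False by (simp add: gf4_char2)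
qed

lemma aut_label_representatives:
  assumes m: "m \<ge> 2"
  shows "map (aut_label (SL2_ltimes_mat m)) (representatives m) = [0, 1, 2, 3, 4, 5, 6]"
proof -
  have nz: "rows2 m (unit_row 0) f \<noteq> 0\<^sub>m 2 m" for f
    using m by (auto simp: zero_rows2 rows2_eq_iff intro: exI[of _ 0])
  have zero: "mat2 a b c d * 0\<^sub>m 2 m = 0\<^sub>m 2 m" for a b c d :: gf4
    by (simp add: zero_rows2 mult_mat2_rows2)
  have one: "1\<^sub>m 2 * 1\<^sub>m 2 = (1\<^sub>m 2 :: gf4 mat)" "1\<^sub>m 2 * 0\<^sub>m 2 m = (0\<^sub>m 2 m :: gf4 mat)"
    "1\<^sub>m 2 * rows2 m f g = rows2 m f g" for f g :: "nat \<Rightarrow> gf4"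
    by (simp_all add: left_mult_one_mat[OF rows2_carrier])
  note calc = aut_label_def one_SL2_ltimes_mat mult_SL2_ltimes_mat mult_mat2 nz zero one add_rows2
    commutes_with_conjugates_translation not_commutes_with_conjugates_companion
    is_group_square_rank_1 not_is_group_square_rank_2[OF m] gf4_char2
  have "aut_label (SL2_ltimes_mat m) (1\<^sub>m 2, 0\<^sub>m 2 m :: gf4 mat) = 0"
    by (simp add: calc)
  moreover have "aut_label (SL2_ltimes_mat m) (1\<^sub>m 2, rows2 m (unit_row 0) (\<lambda>_. 0)) = 1"
    "aut_label (SL2_ltimes_mat m) (1\<^sub>m 2, rows2 m (unit_row 0) (unit_row 1)) = 2"
    by (simp_all add: calc zero_rows2[symmetric] del: One_nat_def)
  moreover have "aut_label (SL2_ltimes_mat m) (companion 0, 0\<^sub>m 2 m) = 3"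
    "aut_label (SL2_ltimes_mat m) (companion 1, 0\<^sub>m 2 m) = 5"
    by (simp_all add: calc one_mat2 mat2_eq_iff)
  \<comment> \<open>The square is a nonzero translation, and the third and fifth powers have first
    component \<open>companion 0\<close>. All tests fail and the default remains.\<close>
  moreover have "aut_label (SL2_ltimes_mat m) (companion 0, rows2 m (unit_row 0) (\<lambda>_. 0)) = 4"
    using m by (simp add: calc mult_mat2_rows2 one_mat2 mat2_eq_iff zero_rows2 rows2_eq_iff)
  moreover have "aut_label (SL2_ltimes_mat m) (companion gf4_gen, 0\<^sub>m 2 m) = 6"
    by (simp add: calc one_mat2 mat2_eq_iff one_gf4_def zero_gf4_def)
  ultimately show ?thesis by (simp add: representatives_def)
qed

lemma num_aut_orbits_SL2_ltimes_mat:
  assumes m: "m \<ge> 2"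
  shows "num_aut_orbits (SL2_ltimes_mat m :: (gf4 mat \<times> gf4 mat) monoid) = 7"
proof -
  let ?G = "SL2_ltimes_mat m :: (gf4 mat \<times> gf4 mat) monoid"
  interpret group ?G by (rule group_SL2_ltimes_mat)
  have distinct: "distinct (map (aut_label ?G) (representatives m))"
    by (simp add: aut_label_representatives[OF m])
  have "set (representatives m) \<subseteq> carrier ?G"
    by (auto simp: representatives_def carrier_SL2_ltimes_mat det_mat2 gf4_char2)
  then have "num_aut_orbits ?G = card (set (representatives m))"
    using aut_equiv_representative[OF _ m] aut_label_cong distinct
    by (intro num_aut_orbits_eq_card_representatives[where c = "aut_label ?G"])
      (auto simp: distinct_map)
  also have "\<dots> = 7"
    using distinct by (simp add: distinct_map distinct_card) (simp add: representatives_def)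
  finally show ?thesis .
qed

section \<open>Solvability and order\<close>

text \<open>Monotonicity of \<open>derived\<close> carries \<open>S\<close> from each term of the
  derived series to the next, so no term is trivial.\<close>

lemma (in group) not_solvable_if_subset_derived:
  assumes S: "S \<subseteq> carrier G" "S \<subseteq> derived G S" and g: "g \<in> S" "g \<noteq> \<one>"
  shows "\<not> solvable G"
proof -
  have "S \<subseteq> (derived G ^^ n) (carrier G)" for n
  proof (induction n)
    case (Suc n)
    from mono_derived[OF this] S(2) show ?case by simp
  qed (simp add: S(1))
  with g show ?thesis by (fastforce simp: solvable_iff_trivial_derived_seq)
qed

text \<open>The inverses enter as given elements \<open>x'\<close> and \<open>y'\<close>, so that
  commutators of explicit matrices can be computed.\<close>

lemma (in group) commutator_in_derived:
  assumes "x \<in> S" "y \<in> S" "S \<subseteq> carrier G" "x' \<in> carrier G" "y' \<in> carrier G"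
    "x' \<otimes> x = \<one>" "y' \<otimes> y = \<one>"
  shows "x \<otimes> y \<otimes> x' \<otimes> y' \<in> derived G S"
proof -
  have "x \<in> carrier G" "y \<in> carrier G" using assms by auto
  then have "inv x = x'" "inv y = y'"
    using assms by (auto intro: inv_equality)
  with assms(1,2) show ?thesis
    unfolding derived_def by (blast intro: generate.incl)
qed

lemma not_solvable_SL2_ltimes_mat:
  "\<not> solvable (SL2_ltimes_mat m :: (gf4 mat \<times> gf4 mat) monoid)"
proof -
  let ?G = "SL2_ltimes_mat m :: (gf4 mat \<times> gf4 mat) monoid"
  interpret group ?G by (rule group_SL2_ltimes_mat)
  let ?w = gf4_gen and ?w' = "GF4 1 1"
  define U where "U (x :: gf4) = (mat2 1 x 0 1, 0\<^sub>m 2 m :: gf4 mat)" for x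
  define L where "L (x :: gf4) = (mat2 1 0 x 1, 0\<^sub>m 2 m :: gf4 mat)" for x
  define D where "D = (mat2 ?w 0 0 ?w', 0\<^sub>m 2 m :: gf4 mat)"
  define D' where "D' = (mat2 ?w' 0 0 ?w, 0\<^sub>m 2 m :: gf4 mat)"
  define S where "S = range U \<union> range L \<union> {D}"
  have zero: "mat2 a b c d * 0\<^sub>m 2 m = 0\<^sub>m 2 m" for a b c d :: gf4
    by (simp add: zero_rows2 mult_mat2_rows2)
  have carrier: "U x \<in> carrier ?G" "L x \<in> carrier ?G" "D \<in> carrier ?G" "D' \<in> carrier ?G" for x
    by (simp_all add: U_def L_def D_def D'_def carrier_SL2_ltimes_mat det_mat2)
      (simp_all add: one_gf4_def)
  then have S: "S \<subseteq> carrier ?G" by (auto simp: S_def)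
  have in_S: "U x \<in> S" "L x \<in> S" "D \<in> S" for x by (auto simp: S_def)
  have inverses: "U x \<otimes>\<^bsub>?G\<^esub> U x = \<one>\<^bsub>?G\<^esub>" "L x \<otimes>\<^bsub>?G\<^esub> L x = \<one>\<^bsub>?G\<^esub>" "D' \<otimes>\<^bsub>?G\<^esub> D = \<one>\<^bsub>?G\<^esub>" for x
    by (simp_all add: U_def L_def D_def D'_def mult_SL2_ltimes_mat one_SL2_ltimes_mat mult_mat2 zero
        one_mat2 gf4_char2) (simp_all add: one_gf4_def zero_gf4_def)
  have U: "U x \<in> derived ?G S" for x
  proof -
    \<comment> \<open>Conjugation by \<open>D\<close> multiplies the parameter of \<open>U\<close>
      by \<open>?w * ?w = ?w'\<close>, so the commutator with \<open>U y\<close> is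
      \<open>U ((?w' + 1) * y) = U (?w * y)\<close>, and \<open>y = ?w' * x\<close> gives
      \<open>U x\<close>. For \<open>L\<close> the roles of \<open>?w\<close> and \<open>?w'\<close>
      are exchanged.\<close>
    have "D \<otimes>\<^bsub>?G\<^esub> U (?w' * x) \<otimes>\<^bsub>?G\<^esub> D' \<otimes>\<^bsub>?G\<^esub> U (?w' * x) = U x"
      by (cases x rule: gf4_exhaust)
        (simp_all add: D_def D'_def U_def mult_SL2_ltimes_mat mult_mat2 mat2_eq_iff zero
          one_gf4_def zero_gf4_def)
    moreover have "D \<otimes>\<^bsub>?G\<^esub> U (?w' * x) \<otimes>\<^bsub>?G\<^esub> D' \<otimes>\<^bsub>?G\<^esub> U (?w' * x) \<in> derived ?G S"
      by (intro commutator_in_derived in_S S carrier inverses)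
    ultimately show ?thesis by simp
  qed
  have L: "L x \<in> derived ?G S" for x
  proof -
    have "D \<otimes>\<^bsub>?G\<^esub> L (?w * x) \<otimes>\<^bsub>?G\<^esub> D' \<otimes>\<^bsub>?G\<^esub> L (?w * x) = L x"
      by (cases x rule: gf4_exhaust)
        (simp_all add: D_def D'_def L_def mult_SL2_ltimes_mat mult_mat2 mat2_eq_iff zero
          one_gf4_def zero_gf4_def)
    moreover have "D \<otimes>\<^bsub>?G\<^esub> L (?w * x) \<otimes>\<^bsub>?G\<^esub> D' \<otimes>\<^bsub>?G\<^esub> L (?w * x) \<in> derived ?G S"
      by (intro commutator_in_derived in_S S carrier inverses)
    ultimately show ?thesis by simp
  qed
  interpret derived: subgroup "derived ?G S" ?G by (rule derived_is_subgroup[OF S])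
  \<comment> \<open>Each bracket has the form \<open>U t\<close>, \<open>L (inverse t)\<close>,
    \<open>U t\<close>, whose product is antidiagonal with entries \<open>t\<close> and
    \<open>inverse t\<close>; here \<open>t\<close> is \<open>?w\<close> and then 1.\<close>
  have "D = (U ?w \<otimes>\<^bsub>?G\<^esub> L ?w' \<otimes>\<^bsub>?G\<^esub> U ?w) \<otimes>\<^bsub>?G\<^esub> (U 1 \<otimes>\<^bsub>?G\<^esub> L 1 \<otimes>\<^bsub>?G\<^esub> U 1)"
    by (simp add: D_def U_def L_def mult_SL2_ltimes_mat mult_mat2 mat2_eq_iff zero one_gf4_def zero_gf4_def)
  also have "\<dots> \<in> derived ?G S" by (intro derived.m_closed U L)
  finally have "S \<subseteq> derived ?G S" using U L by (auto simp: S_def)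
  moreover have "U 1 \<noteq> \<one>\<^bsub>?G\<^esub>"
    by (simp add: U_def one_SL2_ltimes_mat one_mat2 mat2_eq_iff)
  ultimately show ?thesis
    using not_solvable_if_subset_derived[OF S _ in_S(1)] by blast
qed

section \<open>Orders of the groups\<close>

lemma
  shows card_carrier_mat: "card (carrier_mat n m :: 'a :: finite mat set) = card (UNIV :: 'a set) ^ (n * m)"
    and finite_carrier_mat: "finite (carrier_mat n m :: 'a :: finite mat set)"
proof -
  let ?S = "{..<n} \<times> {..<m}"
  let ?E = "?S \<rightarrow>\<^sub>E (UNIV :: 'a set)"
  have "bij_betw (\<lambda>X. restrict (\<lambda>ij. X $$ ij) ?S) (carrier_mat n m) ?E"
  proof (rule bij_betw_byWitness[where f' = "mat n m"])
    show "\<forall>X \<in> carrier_mat n m. mat n m (restrict (\<lambda>ij. X $$ ij) ?S) = X"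
      by (auto intro!: eq_matI)
    show "\<forall>f \<in> ?E. restrict (\<lambda>ij. mat n m f $$ ij) ?S = f"
      by (auto simp: fun_eq_iff PiE_def extensional_def)
  qed (auto split: if_splits)
  moreover have "finite ?E" by (intro finite_PiE) auto
  ultimately show "finite (carrier_mat n m :: 'a mat set)"
    "card (carrier_mat n m :: 'a mat set) = card (UNIV :: 'a set) ^ (n * m)"
    by (auto simp: bij_betw_finite card_PiE dest: bij_betw_same_card)
qed

lemma finite_SL2_ltimes_mat: "finite (carrier (SL2_ltimes_mat m :: ('a :: {field, finite} mat \<times> 'a mat) monoid))"
proof (rule finite_subset)
  show "carrier (SL2_ltimes_mat m) \<subseteq> carrier_mat 2 2 \<times> (carrier_mat 2 m :: 'a mat set)"
    by (auto simp: carrier_SL2_ltimes_mat)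
qed (intro finite_cartesian_product finite_carrier_mat)

text \<open>With \<open>q\<close> the size of the field, the order is that of the special linear
  group times \<open>q^(2 m)\<close>, and \<open>q > 1\<close> makes the exponent
  recoverable.\<close>

lemma card_SL2_ltimes_mat_inj:
  fixes G :: "nat \<Rightarrow> ('a :: {field, finite} mat \<times> 'a mat) monoid"
  defines "G \<equiv> SL2_ltimes_mat"
  assumes eq: "card (carrier (G m)) = card (carrier (G n))"
  shows "m = n"
proof -
  let ?SL = "{A :: 'a mat. A \<in> carrier_mat 2 2 \<and> det A = 1}"
  have "finite ?SL" by (rule finite_subset[OF _ finite_carrier_mat[of 2 2]]) auto
  moreover have "1\<^sub>m 2 \<in> ?SL" by simp
  ultimately have pos: "card ?SL > 0" by (metis (no_types, lifting) card_gt_0_iff empty_iff)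
  have "carrier (G k) = ?SL \<times> carrier_mat 2 k" for k
    by (auto simp: G_def carrier_SL2_ltimes_mat)
  then have "card (carrier (G k)) = card ?SL * card (UNIV :: 'a set) ^ (2 * k)" for k
    by (simp only: card_cartesian_product card_carrier_mat)
  with eq pos have "card (UNIV :: 'a set) ^ (2 * m) = card (UNIV :: 'a set) ^ (2 * n)" by simp
  moreover have "card (UNIV :: 'a set) > 1"
    using card_mono[of "UNIV :: 'a set" "{0, 1}"] by simp
  ultimately show ?thesis by (simp add: power_inject_exp)
qed

theorem mainTheorem4:
  shows "(\<forall>m \<ge> 2. num_aut_orbits (SL2_ltimes_mat m :: (gf4 mat \<times> gf4 mat) monoid) = 7) \<and>
    (\<exists>S :: (gf4 mat \<times> gf4 mat) monoid set.
       infinite S \<and>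
       (\<forall>G \<in> S. group G \<and> finite (carrier G) \<and> \<not> solvable G \<and> num_aut_orbits G = 7) \<and>
       pairwise (\<lambda>G H. \<not> G \<cong> H) S)"
proof (intro conjI exI[of _ "SL2_ltimes_mat ` {2..}"])
  let ?G = "SL2_ltimes_mat :: nat \<Rightarrow> (gf4 mat \<times> gf4 mat) monoid"
  show "\<forall>m \<ge> 2. num_aut_orbits (?G m) = 7"
    by (simp add: num_aut_orbits_SL2_ltimes_mat)
  \<comment> \<open>Equal groups have equal orders, so different \<open>m\<close> give different
    groups and the family is infinite.\<close>
  have "inj ?G"
    by (rule injI, rule card_SL2_ltimes_mat_inj[where 'a = gf4]) simp
  then show "infinite (?G ` {2..})"
    by (simp add: finite_image_iff inj_on_subset infinite_Ici)
  show "\<forall>G \<in> ?G ` {2..}. group G \<and> finite (carrier G) \<and> \<not> solvable G \<and> num_aut_orbits G = 7"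
    by (simp add: group_SL2_ltimes_mat finite_SL2_ltimes_mat not_solvable_SL2_ltimes_mat
        num_aut_orbits_SL2_ltimes_mat)
  show "pairwise (\<lambda>G H. \<not> G \<cong> H) (?G ` {2..})"
    unfolding pairwise_image
  proof (rule pairwiseI)
    fix m n :: nat assume "m \<noteq> n"
    then show "?G m \<noteq> ?G n \<longrightarrow> \<not> ?G m \<cong> ?G n"
      using iso_same_card[of "?G m" "?G n"] card_SL2_ltimes_mat_inj[where 'a = gf4, of m n] by blast
  qed
qed

end
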